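(* Let $D'\le n'$ be positive integers. Consider any algorithm $A$ that solves rendezvous for agents with labels from the set $\{1,\dots,L\}$. There exist $n\in\Theta(n')$ and $D\in\Theta(D')$ such that if $A$ uses time $O(D)$ in the $n$-node oriented ring whenever the initial distance between the agents is $D$, then the required size of advice is $\Omega(\log\log L)$.
   Context: Rendezvous model: the network is an undirected connected graph with $n$ unlabeled nodes; at each node $v$ of degree $d$ the incident edges carry distinct port numbers $0,\dots,d-1$. Two agents start at different nodes and move in synchronous rounds: in each round an agent either stays or chooses a port and moves along the corresponding edge; on entering a node it learns the degree and entry port. Agents cannot mark nodes, cannot communicate before meeting, and do not notice crossing inside an edge. Each agent has a distinct label from $\{1,\dots,L\}$, knows its own label but not the other's. The adversary wakes the agents possibly in different rounds. Both run the same deterministic algorithm with inputs its own label and an advice string given identically to both agents by an oracle knowing the whole instance (graph, port numbering, starting positions, wake-up rounds, both labels); the size of advice is the length of this string. Rendezvous means both agents at the same node in the same round; time is the number of rounds from the wake-up of the later agent until the meeting. An oriented ring is a cycle in which every edge has port number $0$ at one endpoint and $1$ at the other, so that at each node taking port $0$ means going clockwise and port $1$ going counterclockwise. *)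

theory Defs
  imports "Graph_Theory.Graph_Theory"
begin

text \<open>
  Networks are finite simple connected graphs, i.e. symmetric loop-free digraphs on pairs.
  \<open>port v w\<close> is the port number at \<open>v\<close> of the edge between \<open>v\<close> and \<open>w\<close>. The names of the nodes are
  never revealed to the agents.
\<close>

definition port_numbering :: "'v pair_pre_digraph \<Rightarrow> ('v \<Rightarrow> 'v \<Rightarrow> nat) \<Rightarrow> bool" where
  "port_numbering G port \<longleftrightarrow>
     (\<forall>v \<in> pverts G. bij_betw (port v) {w. (v, w) \<in> parcs G} {..<out_degree G v})"

definition network :: "'v pair_pre_digraph \<Rightarrow> ('v \<Rightarrow> 'v \<Rightarrow> nat) \<Rightarrow> bool" where
  "network G port \<longleftrightarrow> pair_graph G \<and> Digraph_Component.connected G \<and> port_numbering G port"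

definition follow :: "'v pair_pre_digraph \<Rightarrow> ('v \<Rightarrow> 'v \<Rightarrow> nat) \<Rightarrow> 'v \<Rightarrow> nat \<Rightarrow> 'v" where
  "follow G port v p = (THE w. (v, w) \<in> parcs G \<and> port v w = p)"

text \<open>
  An observation consists of the degree of the current node and, if the agent has just entered the
  node along an edge, the entry port. A history contains the observation made at wake-up followed by
  one observation per completed round, so its length reveals the local time; the agent's own past
  actions are determined by the history. An algorithm maps label, advice and history to an action:
  \<open>None\<close> is to stay, \<open>Some p\<close> is to take port \<open>p\<close>.
\<close>

type_synonym observation = "nat \<times> nat option"
type_synonym advice = "bool list"
type_synonym algorithm = "nat \<Rightarrow> advice \<Rightarrow> observation list \<Rightarrow> nat option"

text \<open>Choosing a nonexistent port amounts to staying.\<close>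

fun agent_step :: "'v pair_pre_digraph \<Rightarrow> ('v \<Rightarrow> 'v \<Rightarrow> nat) \<Rightarrow> (observation list \<Rightarrow> nat option)
    \<Rightarrow> 'v \<times> observation list \<Rightarrow> 'v \<times> observation list" where
  "agent_step G port act (v, h) =
     (let stay = (v, h @ [(out_degree G v, None)]) in
      case act h of
        None \<Rightarrow> stay
      | Some p \<Rightarrow>
          if p < out_degree G v
          then (let w = follow G port v p in (w, h @ [(out_degree G w, Some (port w v))]))
          else stay)"

record agent =
  label :: nat
  start :: nat
  wakeup :: nat

record scenario =
  net :: "nat pair_pre_digraph"
  ports :: "nat \<Rightarrow> nat \<Rightarrow> nat"
  agent1 :: agent
  agent2 :: agent

type_synonym advice_oracle = "scenario \<Rightarrow> advice"

text \<open>Natural-number subtraction keeps an agent at its starting node until its wake-up round.\<close>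

definition position :: "algorithm \<Rightarrow> advice \<Rightarrow> scenario \<Rightarrow> agent \<Rightarrow> nat \<Rightarrow> nat" where
  "position A s I a t =
     fst ((agent_step (net I) (ports I) (A (label a) s) ^^ (t - wakeup a))
            (start a, [(out_degree (net I) (start a), None)]))"

definition together :: "algorithm \<Rightarrow> advice_oracle \<Rightarrow> scenario \<Rightarrow> nat \<Rightarrow> bool" where
  "together A orc I t \<longleftrightarrow>
     position A (orc I) I (agent1 I) t = position A (orc I) I (agent2 I) t"

definition scenarios :: "nat \<Rightarrow> scenario set" where
  "scenarios L = {I. network (net I) (ports I)
     \<and> start (agent1 I) \<in> pverts (net I) \<and> start (agent2 I) \<in> pverts (net I)
     \<and> start (agent1 I) \<noteq> start (agent2 I)
     \<and> label (agent1 I) \<in> {1..L} \<and> label (agent2 I) \<in> {1..L}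
     \<and> label (agent1 I) \<noteq> label (agent2 I)}"

definition solves_rendezvous :: "nat \<Rightarrow> algorithm \<Rightarrow> advice_oracle \<Rightarrow> bool" where
  "solves_rendezvous L A orc \<longleftrightarrow> (\<forall>I \<in> scenarios L. \<exists>t. together A orc I t)"

text \<open>Finding the agent that is still dormant counts as rendezvous in time 0.\<close>

definition rendezvous_time :: "algorithm \<Rightarrow> advice_oracle \<Rightarrow> scenario \<Rightarrow> nat" where
  "rendezvous_time A orc I =
     (LEAST t. together A orc I t) - max (wakeup (agent1 I)) (wakeup (agent2 I))"

text \<open>For \<open>n < 3\<close> the following is not a cycle; this case is excluded in \<open>ring_scenarios\<close>.\<close>

definition ring_graph :: "nat \<Rightarrow> nat pair_pre_digraph" where
  "ring_graph n = \<lparr> pverts = {..<n},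
     parcs = {(u, v). u < n \<and> v < n \<and> (v = (u + 1) mod n \<or> u = (v + 1) mod n)} \<rparr>"

definition ring_port :: "nat \<Rightarrow> nat \<Rightarrow> nat \<Rightarrow> nat" where
  "ring_port n u v = (if v = (u + 1) mod n then 0 else 1)"

definition graph_dist :: "'v pair_pre_digraph \<Rightarrow> 'v \<Rightarrow> 'v \<Rightarrow> ereal" where
  "graph_dist G u v = wf_digraph.\<mu> (with_proj G) (\<lambda>_. 1) u v"

definition ring_scenarios :: "nat \<Rightarrow> nat \<Rightarrow> nat \<Rightarrow> scenario set" where
  "ring_scenarios L n D = {I \<in> scenarios L. n \<ge> 3 \<and> net I = ring_graph n \<and> ports I = ring_port n
     \<and> graph_dist (net I) (start (agent1 I)) (start (agent2 I)) = ereal (real D)}"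

text \<open>
  The supremum is taken in \<open>ereal\<close> because infinitely many choices of wake-up rounds may lead to
  unbounded advice; over an empty set of scenarios it is \<open>-\<infinity>\<close>.
\<close>

definition advice_size :: "advice_oracle \<Rightarrow> scenario set \<Rightarrow> ereal" where
  "advice_size orc S = (SUP I \<in> S. ereal (real (length (orc I))))"

end

theory Submission
  imports Defs
begin

text \<open>
  In an oriented ring the observations reveal nothing, so label and advice determine the displacement
  of an agent from its starting node. Take \<open>D = 4 D'\<close> and \<open>n = 8 n'\<close>, so that
  \<open>n \<ge> 2 D\<close>, and record the displacement only every \<open>D'\<close> rounds and only up to a multiple
  of \<open>D'\<close>. Up to time \<open>c D\<close> this leaves a number \<open>M\<close> of possible traces that
  depends on \<open>c\<close> alone, and two agents with equal traces never drift apart by \<open>3 D'\<close> or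
  more, so they do not meet if they start simultaneously at distance \<open>D\<close>. With advice of size at
  most \<open>k\<close> there are fewer than \<open>2 ^ (k + 1)\<close> advice strings; if \<open>L\<close> exceeds
  \<open>M ^ 2 ^ (k + 1)\<close>, two labels have equal traces under every one of them. Hence
  \<open>log log L \<le> k + 1 + log log M\<close>.
\<close>

subsection \<open>The oriented ring\<close>

text \<open>The covering map from the integers onto the ring: moves become integer addition, and
  wrap-around only shows up as divisibility by \<open>n\<close>.\<close>

definition ring_node :: "nat \<Rightarrow> int \<Rightarrow> nat" where
  "ring_node n z = nat (z mod int n)"

lemma ring_node_less: "0 < n \<Longrightarrow> ring_node n z < n"
  by (simp add: ring_node_def nat_less_iff)

lemma ring_node_of_nat: "v < n \<Longrightarrow> ring_node n (int v) = v"
  by (simp add: ring_node_def)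

lemma ring_node_eq_iff: "0 < n \<Longrightarrow> ring_node n y = ring_node n z \<longleftrightarrow> int n dvd y - z"
  by (simp add: ring_node_def nat_eq_iff mod_eq_dvd_iff)

lemma Suc_ring_node: "0 < n \<Longrightarrow> (ring_node n z + 1) mod n = ring_node n (z + 1)"
proof -
  assume "0 < n"
  then have "int ((ring_node n z + 1) mod n) = int (ring_node n (z + 1))"
    by (simp add: ring_node_def zmod_int mod_simps add.commute)
  then show ?thesis by simp
qed

lemma ring_node_neighbours_distinct:
  "3 \<le> n \<Longrightarrow> ring_node n (z + 1) \<noteq> ring_node n (z - 1)"
  "3 \<le> n \<Longrightarrow> ring_node n (z - 1) \<noteq> ring_node n (z + 1)"
  by (auto simp: ring_node_eq_iff dest!: zdvd_imp_le)

lemma ring_arc_iff: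
  assumes "3 \<le> n"
  shows "(ring_node n z, w) \<in> parcs (ring_graph n) \<longleftrightarrow>
    w = ring_node n (z + 1) \<or> w = ring_node n (z - 1)"
proof (cases "w < n")
  case True
  define y where "y = int w"
  have w: "w = ring_node n y"
    using True by (simp add: y_def ring_node_of_nat)
  \<comment> \<open>The arc relation is symmetric in its two disjuncts; the second one is solved
    here for the endpoint.\<close>
  have "ring_node n z = ring_node n (y + 1) \<longleftrightarrow> ring_node n y = ring_node n (z - 1)"
    using assms dvd_minus_iff[of "int n" "z - (y + 1)"]
    by (simp add: ring_node_eq_iff algebra_simps)
  then show ?thesis
    using assms Suc_ring_node[of n z] Suc_ring_node[of n y] ring_node_less[of n]
    by (simp add: ring_graph_def w)
next
  case False
  then show ?thesis
    using assms ring_node_less[of n] by (auto simp: ring_graph_def)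
qed

lemma ring_graph_sym: "(u, v) \<in> parcs (ring_graph n) \<longleftrightarrow> (v, u) \<in> parcs (ring_graph n)"
  by (auto simp: ring_graph_def)

lemma ring_port_forward: "0 < n \<Longrightarrow> ring_port n (ring_node n z) (ring_node n (z + 1)) = 0"
  using Suc_ring_node[of n z] by (simp add: ring_port_def)

lemma ring_port_backward:
  "3 \<le> n \<Longrightarrow> ring_port n (ring_node n z) (ring_node n (z - 1)) = 1"
  using Suc_ring_node[of n z] ring_node_neighbours_distinct[of n z] by (simp add: ring_port_def)

lemma ring_out_arcs:
  assumes "3 \<le> n"
  shows "{w. (ring_node n z, w) \<in> parcs (ring_graph n)} = {ring_node n (z + 1), ring_node n (z - 1)}"
  using assms by (auto simp: ring_arc_iff)

lemma ring_out_degree: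
  assumes "3 \<le> n"
  shows "out_degree (with_proj (ring_graph n)) (ring_node n z) = 2"
proof -
  have "out_arcs (with_proj (ring_graph n)) (ring_node n z)
      = Pair (ring_node n z) ` {w. (ring_node n z, w) \<in> parcs (ring_graph n)}"
    by (auto simp: out_arcs_def)
  then show ?thesis
    using assms ring_node_neighbours_distinct[of n z]
    by (simp add: out_degree_def ring_out_arcs card_image inj_on_def)
qed

lemma ring_follow:
  assumes "3 \<le> n"
  shows "follow (ring_graph n) (ring_port n) (ring_node n z) 0 = ring_node n (z + 1)"
    and "follow (ring_graph n) (ring_port n) (ring_node n z) 1 = ring_node n (z - 1)"
  using assms ring_port_forward[of n z] ring_port_backward[of n z]
  by (auto simp: follow_def ring_arc_iff intro!: the_equality)

lemma pair_graph_ring: "3 \<le> n \<Longrightarrow> pair_graph (ring_graph n)"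
proof
  assume n: "3 \<le> n"
  show "finite (parcs (ring_graph n))"
    by (rule finite_subset[of _ "{..<n} \<times> {..<n}"]) (auto simp: ring_graph_def)
  show "fst e \<noteq> snd e" if "e \<in> parcs (ring_graph n)" for e
    using that n by (auto simp: ring_graph_def mod_Suc split: if_splits)
  show "symmetric (with_proj (ring_graph n))"
    using ring_graph_sym by (auto simp: symmetric_def intro!: symI)
qed (auto simp: ring_graph_def)

section \<open>Walks, distances and connectedness in the ring\<close>

lemma ring_walk_exists:
  assumes "3 \<le> n"
  shows "\<exists>p. pre_digraph.awalk (with_proj (ring_graph n)) (ring_node n z) p (ring_node n (z + int d))
    \<and> length p = d"
proof -
  interpret pair_graph "ring_graph n" by (rule pair_graph_ring[OF assms])
  show ?thesis
  proof (induction d)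
    case 0
    then show ?case
      using assms ring_node_less[of n z]
      by (intro exI[of _ "[]"]) (simp add: awalk_Nil_iff, simp add: ring_graph_def)
  next
    case (Suc d)
    then obtain p where p: "awalk (ring_node n z) p (ring_node n (z + int d))" "length p = d"
      by blast
    let ?e = "(ring_node n (z + int d), ring_node n (z + int d + 1))"
    have "?e \<in> parcs (ring_graph n)"
      using assms by (simp add: ring_arc_iff)
    then have "awalk (ring_node n (z + int d)) [?e] (ring_node n (z + int d + 1))"
      using arc_implies_awalk[of ?e] by simp
    from awalk_appendI[OF p(1) this] show ?case
      using p(2) by (intro exI[of _ "p @ [?e]"]) (simp add: add.assoc add.commute[of 1])
  qed
qed

text \<open>Every walk lifts to the integers, each arc contributing 1 or -1.\<close>

lemma ring_walk_displacement:
  assumes "3 \<le> n"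
    and "pre_digraph.awalk (with_proj (ring_graph n)) (ring_node n z) p v"
  shows "\<exists>k. \<bar>k\<bar> \<le> int (length p) \<and> v = ring_node n (z + k)"
proof -
  interpret pair_graph "ring_graph n" by (rule pair_graph_ring[OF assms(1)])
  show ?thesis
    using assms(2)
  proof (induction p arbitrary: z)
    case Nil
    then show ?case by (auto simp: awalk_Nil_iff intro!: exI[of _ 0])
  next
    case (Cons e p)
    then have e: "e \<in> parcs (ring_graph n)" "fst e = ring_node n z" "awalk (snd e) p v"
      by (auto simp: awalk_Cons_iff)
    then have "(ring_node n z, snd e) \<in> parcs (ring_graph n)"
      by (metis prod.collapse)
    then obtain s where s: "\<bar>s\<bar> = 1" "snd e = ring_node n (z + s)"
      using ring_arc_iff[OF assms(1)] by (metis abs_1 abs_minus_cancel diff_conv_add_uminus)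
    with Cons.IH[of "z + s"] e obtain k where
      "\<bar>k\<bar> \<le> int (length p)" "v = ring_node n (z + s + k)" by auto
    with s show ?case by (intro exI[of _ "s + k"]) (auto simp: algebra_simps)
  qed
qed

text \<open>The clockwise walk gives the upper bound. A shorter walk would lift to a displacement
  \<open>k\<close> with \<bar>k\<bar> < d, making \<open>d - k\<close> a multiple of
  \<open>n\<close> strictly between 0 and 2 * d \<le> n.\<close>

lemma ring_graph_dist:
  assumes n: "3 \<le> n" and d: "2 * d \<le> n"
  shows "graph_dist (ring_graph n) (ring_node n z) (ring_node n (z + int d)) = ereal (real d)"
proof -
  interpret pair_graph "ring_graph n" by (rule pair_graph_ring[OF n])
  have cost: "awalk_cost (\<lambda>_. 1) p = real (length p)" for p
    by (induction p) auto
  have "d \<le> length p" if walk: "awalk (ring_node n z) p (ring_node n (z + int d))" for p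
  proof (rule ccontr)
    assume "\<not> d \<le> length p"
    moreover obtain k where k: "\<bar>k\<bar> \<le> int (length p)"
      "ring_node n (z + int d) = ring_node n (z + k)"
      using ring_walk_displacement[OF n walk] by blast
    ultimately have "0 < int d - k" "int d - k < int n" "int n dvd int d - k"
      using d n by (auto simp: ring_node_eq_iff)
    then show False using zdvd_imp_le by fastforce
  qed
  then show ?thesis
    unfolding graph_dist_def \<mu>_def cost using ring_walk_exists[OF n, of z d]
    by (intro antisym) (auto intro!: INF_greatest intro: INF_lower2)
qed

lemma network_ring:
  assumes n: "3 \<le> n"
  shows "network (ring_graph n) (ring_port n)"
proof -
  interpret pair_graph "ring_graph n" by (rule pair_graph_ring[OF n])
  have "connected (ring_graph n)"
  proof (rule connectedI)
    show "pverts (ring_graph n) \<noteq> {}" using n by (simp add: ring_graph_def lessThan_empty_iff)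
  next
    fix u v assume uv: "u \<in> pverts (ring_graph n)" "v \<in> pverts (ring_graph n)"
    \<comment> \<open>Going clockwise once past node 0 reaches \<open>v\<close> from
      \<open>u\<close> without comparing the two.\<close>
    have "int u + int (n - u + v) = int n + int v"
      using uv by (auto simp: ring_graph_def)
    then have "ring_node n (int u + int (n - u + v)) = v"
      using uv by (simp add: ring_node_def ring_graph_def)
    moreover have "ring_node n (int u) = u"
      using uv by (simp add: ring_node_of_nat ring_graph_def)
    ultimately obtain p where "awalk u p v"
      using ring_walk_exists[OF n, of "int u" "n - u + v"] by auto
    then show "u \<rightarrow>\<^sup>*\<^bsub>mk_symmetric (ring_graph n)\<^esub> v"
      by (intro reachable_mk_symmetricI reachable_awalkI)
  qed
  moreover have "port_numbering (ring_graph n) (ring_port n)"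
    unfolding port_numbering_def
  proof
    fix v assume "v \<in> pverts (ring_graph n)"
    then have v: "v = ring_node n (int v)"
      by (simp add: ring_graph_def ring_node_of_nat)
    have "bij_betw (ring_port n v) {ring_node n (int v + 1), ring_node n (int v - 1)} {..<2}"
      using n ring_port_forward[of n "int v"] ring_port_backward[of n "int v"] v
      by (auto simp: bij_betw_def numeral_2_eq_2 lessThan_Suc)
    then show "bij_betw (ring_port n v) {w. (v, w) \<in> parcs (ring_graph n)}
      {..<out_degree (with_proj (ring_graph n)) v}"
      using ring_out_arcs[OF n, of "int v"] ring_out_degree[OF n, of "int v"] v by simp
  qed
  ultimately show ?thesis
    using pair_graph_axioms by (simp add: network_def)
qed

subsection \<open>Displacements\<close>

text \<open>The movement of an agent on the universal cover of the ring. Since the degree and the entry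
  ports reveal nothing, it depends neither on the size of the ring nor on the starting node.\<close>

fun line_step :: "(observation list \<Rightarrow> nat option) \<Rightarrow> int \<times> observation list
    \<Rightarrow> int \<times> observation list" where
  "line_step act (z, h) =
     (if act h = Some 0 then (z + 1, h @ [(2, Some 1)])
      else if act h = Some 1 then (z - 1, h @ [(2, Some 0)])
      else (z, h @ [(2, None)]))"

definition displacement :: "(observation list \<Rightarrow> nat option) \<Rightarrow> nat \<Rightarrow> int" where
  "displacement act t = fst ((line_step act ^^ t) (0, [(2, None)]))"

text \<open>The degree is always 2, and the entry port is fixed by the direction of the move: 1
  after a clockwise step, 0 after a counterclockwise one. Hence both sides append the same
  observation, whatever \<open>y\<close> and \<open>n\<close> are.\<close>

lemma agent_step_ring:
  assumes n: "3 \<le> n"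
  shows "agent_step (ring_graph n) (ring_port n) act (apfst (\<lambda>z. ring_node n (y + z)) zh)
    = apfst (\<lambda>z. ring_node n (y + z)) (line_step act zh)"
proof (cases zh)
  case (Pair z h)
  have "ring_port n (ring_node n (y + z + 1)) (ring_node n (y + z)) = 1"
    using ring_port_backward[OF n, of "y + z + 1"] by simp
  moreover have "ring_port n (ring_node n (y + z - 1)) (ring_node n (y + z)) = 0"
    using ring_port_forward[of n "y + z - 1"] n by simp
  \<comment> \<open>Ports from 2 on do not exist, so choosing one amounts to staying, as in the last
    branch of \<open>line_step\<close>.\<close>
  moreover have "p = 0 \<or> p = 1 \<or> \<not> p < 2" for p :: nat by auto
  ultimately show ?thesis
    using ring_follow[OF n, of "y + z"] Pair
    by (fastforce simp: ring_out_degree[OF n] Let_def add.assoc[symmetric] add_diff_eq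
        split: option.split)
qed

lemma position_ring:
  assumes "3 \<le> n" and "net I = ring_graph n" and "ports I = ring_port n"
    and "start a = ring_node n y"
  shows "position A s I a t = ring_node n (y + displacement (A (label a) s) (t - wakeup a))"
proof -
  let ?r = "apfst (\<lambda>z. ring_node n (y + z))"
  have "(agent_step (ring_graph n) (ring_port n) act ^^ m) (?r zh) = ?r ((line_step act ^^ m) zh)"
    for act m zh
    by (induction m) (simp_all only: funpow.simps o_apply id_apply agent_step_ring[OF assms(1)])
  from this[of _ "_" "(0, [(2, None)])"] show ?thesis
    using assms by (simp add: position_def displacement_def ring_out_degree)
qed

lemma displacement_step: "\<bar>displacement act (Suc t) - displacement act t\<bar> \<le> 1"
  by (cases "(line_step act ^^ t) (0, [(2, None)])") (simp add: displacement_def)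

lemma displacement_diff: "\<bar>displacement act (t + m) - displacement act t\<bar> \<le> int m"
proof (induction m)
  case (Suc m)
  then show ?case using displacement_step[of act "t + m"] by simp
qed simp

lemma displacement_bound: "\<bar>displacement act t\<bar> \<le> int t"
  using displacement_diff[of act 0 t] by (simp add: displacement_def)

subsection \<open>Coarse behaviour\<close>

text \<open>The same \<open>b\<close> serves as the time step and as the spatial resolution. The
  restriction fixes the values beyond \<open>J\<close>, so that only finitely many traces
  exist.\<close>

definition block_trace :: "nat \<Rightarrow> nat \<Rightarrow> (observation list \<Rightarrow> nat option) \<Rightarrow> nat \<Rightarrow> int" where
  "block_trace b J act = restrict (\<lambda>j. displacement act (j * b) div int b) {..J}"

lemma block_trace_in:
  assumes "0 < b"
  shows "block_trace b J act \<in> {..J} \<rightarrow>\<^sub>E {- int J..int J}"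
proof (rule PiE_I)
  fix j assume "j \<in> {..J}"
  then have j: "int j \<le> int J" by simp
  have "\<bar>displacement act (j * b)\<bar> \<le> int j * int b"
    using displacement_bound[of act "j * b"] by simp
  then have "(- int j * int b) div int b \<le> displacement act (j * b) div int b"
    "displacement act (j * b) div int b \<le> (int j * int b) div int b"
    using assms by (intro zdiv_mono1; simp)+
  moreover have "(- int j * int b) div int b = - int j" "(int j * int b) div int b = int j"
    using assms by (simp_all only: nonzero_mult_div_cancel_right of_nat_eq_0_iff)
  ultimately have "displacement act (j * b) div int b \<in> {- int j..int j}"
    by simp
  then show "block_trace b J act j \<in> {- int J..int J}"
    using j \<open>j \<in> {..J}\<close> by (auto simp: block_trace_def)
qed (simp add: block_trace_def)

lemma card_block_traces:
  "card ({..J} \<rightarrow>\<^sub>E {- int J..int J}) = (2 * J + 1) ^ (J + 1)"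
  by (simp add: card_PiE nat_add_distrib nat_mult_distrib)

text \<open>At the start of the block containing \<open>t\<close> the displacements have the same
  quotient, so they differ by less than \<open>b\<close>; since then each has changed by at most m <
  b.\<close>

lemma block_trace_eq_imp_close:
  assumes "0 < b" and eq: "block_trace b J act = block_trace b J act'" and "t div b \<le> J"
  shows "\<bar>displacement act t - displacement act' t\<bar> < 3 * int b"
proof -
  define j m where "j = t div b" and "m = t mod b"
  have t: "t = j * b + m" and m: "m < b"
    using assms(1) by (simp_all add: j_def m_def)
  have q: "displacement act (j * b) div int b = displacement act' (j * b) div int b"
    using fun_cong[OF eq, of j] assms(3) by (simp add: block_trace_def j_def)
  have "\<bar>x - y\<bar> < int b" if "x div int b = y div int b" for x y :: int
  proof -
    have "x - y = x mod int b - y mod int b"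
      using that by (simp add: minus_div_mult_eq_mod[symmetric])
    moreover have "0 \<le> x mod int b" "x mod int b < int b" "0 \<le> y mod int b" "y mod int b < int b"
      using assms(1) by simp_all
    ultimately show ?thesis by linarith
  qed
  from this[OF q] show ?thesis
    using displacement_diff[of act "j * b" m] displacement_diff[of act' "j * b" m] m
    unfolding t by linarith
qed

subsection \<open>The lower bound\<close>

lemma card_advice_le: "card {s :: advice. length s \<le> k} \<le> 2 ^ (k + 1)"
proof -
  have "{s :: advice. length s \<le> k} = {s. set s \<subseteq> UNIV \<and> length s \<le> k}" by simp
  also have "card \<dots> = (\<Sum>i\<le>k. 2 ^ i)"
    by (subst card_lists_length_le) simp_all
  also have "\<dots> \<le> 2 ^ (k + 1)"
    by (induction k) simp_all
  finally show ?thesis .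
qed

lemma finite_advice: "finite {s :: advice. length s \<le> k}"
  using finite_lists_length_le[of "UNIV :: bool set" k] by simp

text \<open>The advice may depend on both labels, so the pair must be fixed before the advice is
  known. The pigeonhole principle is therefore applied to whole maps from advice strings to
  traces.\<close>

lemma indistinguishable_labels:
  fixes A :: algorithm
  assumes "0 < b" and L: "((2 * J + 1) ^ (J + 1)) ^ (2 ^ (k + 1)) < L"
  obtains x y where "x \<in> {1..L}" "y \<in> {1..L}" "x \<noteq> y"
    "\<And>s. length s \<le> k \<Longrightarrow> block_trace b J (A x s) = block_trace b J (A y s)"
proof -
  let ?S = "{s :: advice. length s \<le> k}"
  let ?T = "{..J} \<rightarrow>\<^sub>E {- int J..int J}"
  define prof :: "nat \<Rightarrow> advice \<Rightarrow> nat \<Rightarrow> int" where "prof x = restrict (\<lambda>s. block_trace b J (A x s)) ?S" for x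
  have "card (?S \<rightarrow>\<^sub>E ?T) = ((2 * J + 1) ^ (J + 1)) ^ card ?S"
    by (simp add: card_PiE[OF finite_advice] card_block_traces del: power_Suc)
  also have "\<dots> \<le> ((2 * J + 1) ^ (J + 1)) ^ (2 ^ (k + 1))"
    by (rule power_increasing[OF card_advice_le]) (rule one_le_power, simp)
  finally have "card (?S \<rightarrow>\<^sub>E ?T) < card {1..L}" using L by simp
  moreover have "prof ` {1..L} \<subseteq> ?S \<rightarrow>\<^sub>E ?T"
    using block_trace_in[OF assms(1)] by (simp only: prof_def image_subset_iff restrict_PiE_iff) blast
  moreover have "finite (?S \<rightarrow>\<^sub>E ?T)"
    by (intro finite_PiE finite_advice) simp_all
  ultimately have "\<not> inj_on prof {1..L}"
    by (meson card_inj_on_le not_le)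
  then obtain x y where xy: "x \<in> {1..L}" "y \<in> {1..L}" "x \<noteq> y" "prof x = prof y"
    by (auto simp: inj_on_def)
  show thesis
  proof (rule that[OF xy(1-3)])
    fix s :: advice assume "length s \<le> k"
    then show "block_trace b J (A x s) = block_trace b J (A y s)"
      using fun_cong[OF xy(4), of s] by (simp add: prof_def)
  qed
qed

text \<open>Meeting within \<open>c * real (4 * b)\<close> rounds means within 4 * c blocks of
  length \<open>b\<close>, whence the choice of \<open>J\<close>.\<close>

lemma short_advice_imp_few_labels:
  assumes solves: "solves_rendezvous L A orc" and b: "0 < b" "b \<le> n'"
    and J: "J = nat \<lfloor>4 * c\<rfloor>"
    and time: "\<And>I. I \<in> ring_scenarios L (8 * n') (4 * b) \<Longrightarrow>
      real (rendezvous_time A orc I) \<le> c * real (4 * b)"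
    and size: "\<And>I. I \<in> ring_scenarios L (8 * n') (4 * b) \<Longrightarrow> length (orc I) \<le> k"
  shows "L \<le> ((2 * J + 1) ^ (J + 1)) ^ (2 ^ (k + 1))"
proof (rule ccontr)
  assume "\<not> ?thesis"
  then obtain x y where xy: "x \<in> {1..L}" "y \<in> {1..L}" "x \<noteq> y"
    and tr: "\<And>s. length s \<le> k \<Longrightarrow> block_trace b J (A x s) = block_trace b J (A y s)"
    using indistinguishable_labels[OF b(1)] by (metis not_le)
  define n D where "n = 8 * n'" and "D = 4 * b"
  have n: "3 \<le> n" "2 * D \<le> n" "0 < D" using b by (simp_all add: n_def D_def)
  \<comment> \<open>Simultaneous wake-up in round 0 makes the rendezvous time equal to the first
    meeting round.\<close>
  define I where "I = \<lparr>net = ring_graph n, ports = ring_port n,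
    agent1 = \<lparr>label = x, start = ring_node n 0, wakeup = 0\<rparr>,
    agent2 = \<lparr>label = y, start = ring_node n (int D), wakeup = 0\<rparr>\<rparr>"
  have "ring_node n 0 \<noteq> ring_node n (int D)"
    using n by (auto simp: ring_node_eq_iff dest!: zdvd_imp_le)
  then have sc: "I \<in> scenarios L"
    using xy network_ring[OF n(1)] n ring_node_less[of n]
    by (auto simp: scenarios_def I_def ring_graph_def)
  then have rsc: "I \<in> ring_scenarios L n D"
    using ring_graph_dist[OF n(1,2), of 0] n by (simp add: ring_scenarios_def I_def)
  define t where "t = (LEAST t. together A orc I t)"
  have "\<exists>t. together A orc I t"
    using solves sc by (auto simp: solves_rendezvous_def)
  then have "together A orc I t"
    unfolding t_def by (rule LeastI_ex)
  then have "ring_node n (int D + displacement (A y (orc I)) t)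
      = ring_node n (displacement (A x (orc I)) t)"
    using position_ring[OF n(1), of I "agent1 I" 0] position_ring[OF n(1), of I "agent2 I" "int D"]
    by (simp add: together_def I_def)
  then have dvd: "int n dvd int D + displacement (A y (orc I)) t - displacement (A x (orc I)) t"
    using n ring_node_eq_iff[of n] by (metis gr0I mult_is_0 not_numeral_le_zero)
  have "real t \<le> c * real D"
    using time[of I] rsc by (simp add: rendezvous_time_def t_def n_def D_def I_def)
  then have "real t \<le> 4 * c * real b" by (simp add: D_def)
  moreover have "real (t div b) * real b \<le> real t"
    by (metis div_times_less_eq_dividend of_nat_le_iff of_nat_mult)
  ultimately have "real (t div b) * real b \<le> (4 * c) * real b" by linarith
  then have "real (t div b) \<le> 4 * c" using b(1) by simp
  then have "t div b \<le> J" unfolding J by linarith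
  then have "\<bar>displacement (A x (orc I)) t - displacement (A y (orc I)) t\<bar> < 3 * int b"
    using block_trace_eq_imp_close[OF b(1) tr] size[of I] rsc by (simp add: n_def D_def)
  \<comment> \<open>The offset of the lifted positions stays strictly between \<open>b\<close> and
    \<open>7 * b\<close>, while n \<ge> 8 * b, so it cannot vanish modulo \<open>n\<close>.\<close>
  then have "0 < int D + displacement (A y (orc I)) t - displacement (A x (orc I)) t"
    "int D + displacement (A y (orc I)) t - displacement (A x (orc I)) t < int n"
    using n b by (auto simp: D_def)
  then show False using dvd zdvd_imp_le by fastforce
qed

section \<open>Arithmetic of the iterated logarithm\<close>

lemma le_two_power_two_power: "(m::nat) \<le> 2 ^ (2 ^ m)"
  using less_exp[of m] less_exp[of "2 ^ m"] by linarith

lemma log_log_two_power_two_power: "log 2 (log 2 (2 ^ (2 ^ m))) = real m"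
  by (simp add: log_nat_power)

text \<open>Positivity of the inner logarithm is recorded as well, because monotonicity of the outer
  one depends on it.\<close>

lemma log_log_ge:
  assumes "2 ^ (2 ^ m) \<le> L"
  shows "0 < log 2 (real L)" and "real m \<le> log 2 (log 2 (real L))"
proof -
  have large: "(2::real) ^ (2 ^ m) \<le> real L"
    using assms by (metis of_nat_le_iff of_nat_numeral of_nat_power)
  moreover have "(0::real) < 2 ^ (2 ^ m)" by simp
  ultimately have pos: "0 < real L" by linarith
  have le: "log 2 (2 ^ (2 ^ m)) \<le> log 2 (real L)"
    using large pos by (subst log_le_cancel_iff) simp_all
  moreover have pos': "0 < log 2 (2 ^ (2 ^ m) :: real)"
    by (simp add: log_nat_power)
  ultimately show log_pos: "0 < log 2 (real L)" by linarith
  have "log 2 (log 2 (2 ^ (2 ^ m))) \<le> log 2 (log 2 (real L))"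
    using le pos' log_pos by (subst log_le_cancel_iff) simp_all
  then show "real m \<le> log 2 (log 2 (real L))"
    by (simp only: log_log_two_power_two_power)
qed

lemma log_log_le:
  assumes "0 < log 2 (real L)" and "L \<le> 2 ^ (2 ^ m)"
  shows "log 2 (log 2 (real L)) \<le> real m"
proof -
  \<comment> \<open>The convention \<open>log 2 0 = 0\<close> excludes \<open>L = 0\<close>.\<close>
  have "0 < real L" using assms(1) by (cases "L = 0") (simp_all add: log_def)
  moreover have "real L \<le> 2 ^ (2 ^ m)"
    using assms(2) by (metis of_nat_le_iff of_nat_numeral of_nat_power)
  ultimately have "log 2 (real L) \<le> log 2 (2 ^ (2 ^ m))"
    by (subst log_le_cancel_iff) simp_all
  then have "log 2 (log 2 (real L)) \<le> log 2 (log 2 (2 ^ (2 ^ m)))"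
    using assms(1) by (subst log_le_cancel_iff) simp_all
  then show ?thesis by (simp only: log_log_two_power_two_power)
qed

text \<open>Write \<open>l\<close> for the iterated logarithm of \<open>L\<close>. The bound
  \<open>few\<close> gives l \<le> M + k + 1, and \<open>large\<close> gives l \<ge> 2 * M + 3, so
  \<open>M\<close> absorbs at most half of \<open>l\<close> and k \<ge> l / 2 + 1 / 2.\<close>

lemma few_labels_imp_long_advice:
  assumes large: "2 ^ (2 ^ (2 * M + 3)) \<le> L" and few: "L \<le> M ^ (2 ^ (k + 1))"
  shows "1/2 * log 2 (log 2 (real L)) < real k"
proof -
  have "M ^ (2 ^ (k + 1)) \<le> (2 ^ (2 ^ M)) ^ (2 ^ (k + 1))"
    by (rule power_mono[OF le_two_power_two_power]) simp
  also have "\<dots> = 2 ^ (2 ^ (M + k + 1))"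
    by (simp only: power_mult[symmetric] power_add[symmetric] add.assoc)
  finally have "L \<le> 2 ^ (2 ^ (M + k + 1))" using few by linarith
  from log_log_le[OF log_log_ge(1)[OF large] this] log_log_ge(2)[OF large]
  show ?thesis by simp
qed

section \<open>Choice of constants and conclusion\<close>

theorem theorem3:
  shows "\<exists>(a1::real) (a2::real) (b1::real) (b2::real) (\<kappa>::real \<Rightarrow> real) (L0::real \<Rightarrow> nat).
    a1 > 0 \<and> a2 > 0 \<and> b1 > 0 \<and> b2 > 0 \<and> (\<forall>c>0. \<kappa> c > 0) \<and>
    (\<forall>(D'::nat) (n'::nat) (L::nat) (A::algorithm) (orc::advice_oracle).
       1 \<le> D' \<and> D' \<le> n' \<and> solves_rendezvous L A orc \<longrightarrow>
       (\<exists>(n::nat) (D::nat).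
          a1 * real n' \<le> real n \<and> real n \<le> a2 * real n' \<and>
          b1 * real D' \<le> real D \<and> real D \<le> b2 * real D' \<and>
          (\<forall>c>0. L \<ge> L0 c \<and>
             (\<forall>I \<in> ring_scenarios L n D. real (rendezvous_time A orc I) \<le> c * real D) \<longrightarrow>
             advice_size orc (ring_scenarios L n D) \<ge> ereal (\<kappa> c * log 2 (log 2 (real L))))))"
proof -
  \<comment> \<open>\<open>M c\<close> is the number of traces over 4 * c blocks. All dependence on
    \<open>c\<close> goes into the threshold \<open>L0\<close>, so the factor 1/2 works for every
    \<open>c\<close>.\<close>
  define M :: "real \<Rightarrow> nat" where "M c = (2 * nat \<lfloor>4 * c\<rfloor> + 1) ^ (nat \<lfloor>4 * c\<rfloor> + 1)" for c
  define L0 :: "real \<Rightarrow> nat" where "L0 c = 2 ^ (2 ^ (2 * M c + 3))" for c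
  have main: "ereal (1/2 * log 2 (log 2 (real L))) \<le> advice_size orc (ring_scenarios L (8 * n') (4 * D'))"
    (is "ereal ?r \<le> _")
    if "1 \<le> D'" "D' \<le> n'" "solves_rendezvous L A orc" "0 < c" "L0 c \<le> L"
      and time: "\<forall>I \<in> ring_scenarios L (8 * n') (4 * D').
        real (rendezvous_time A orc I) \<le> c * real (4 * D')"
    for D' n' L c and A :: algorithm and orc :: advice_oracle
  proof (rule ccontr)
    assume "\<not> ?thesis"
    then have less: "real (length (orc I)) < ?r" if "I \<in> ring_scenarios L (8 * n') (4 * D')" for I
      using SUP_upper[OF that, of "\<lambda>I. ereal (real (length (orc I)))"]
      unfolding advice_size_def by (metis ereal_less(1) less_ereal.simps(1) not_le order_le_less_trans)
    \<comment> \<open>Advice lengths are integers, so a bound by \<open>?r\<close> is one by its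
      floor, which takes the role of \<open>k\<close>.\<close>
    have size: "length (orc I) \<le> nat \<lfloor>?r\<rfloor>" if "I \<in> ring_scenarios L (8 * n') (4 * D')" for I
      using less[OF that] by linarith
    have few: "L \<le> M c ^ (2 ^ (nat \<lfloor>?r\<rfloor> + 1))"
      unfolding M_def
      by (rule short_advice_imp_few_labels[OF that(3) _ that(2) refl _ size])
        (use that time in auto)
    then have "?r < real (nat \<lfloor>?r\<rfloor>)"
      using few_labels_imp_long_advice that(5) by (simp add: L0_def)
    \<comment> \<open>Without this, \<open>nat\<close> could round a negative \<open>?r\<close> up
      to 0 and there would be no contradiction.\<close>
    moreover have "0 \<le> ?r"
      using log_log_ge(2)[of "2 * M c + 3" L] that(5) by (simp add: L0_def)
    ultimately show False by linarith
  qed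
  have bounds: "8 * real n' \<le> real (8 * n')" "real (8 * n') \<le> 8 * real n'"
    "4 * real D' \<le> real (4 * D')" "real (4 * D') \<le> 4 * real D'" for n' D' :: nat
    by simp_all
  show ?thesis
  proof (rule exI[of _ 8], rule exI[of _ 8], rule exI[of _ 4], rule exI[of _ 4],
      intro exI[of _ "\<lambda>_. 1/2"] exI[of _ L0] conjI allI impI)
    fix D' n' L :: nat and A :: algorithm and orc :: advice_oracle
    assume "1 \<le> D' \<and> D' \<le> n' \<and> solves_rendezvous L A orc"
    then show "\<exists>n D. 8 * real n' \<le> real n \<and> real n \<le> 8 * real n' \<and>
        4 * real D' \<le> real D \<and> real D \<le> 4 * real D' \<and>
        (\<forall>c>0. L \<ge> L0 c \<and>
           (\<forall>I \<in> ring_scenarios L n D. real (rendezvous_time A orc I) \<le> c * real D) \<longrightarrow>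
           advice_size orc (ring_scenarios L n D) \<ge> ereal (1/2 * log 2 (log 2 (real L))))"
      by (intro exI[of _ "8 * n'"] exI[of _ "4 * D'"]) (use bounds main in blast)
  qed simp_all
qed

end
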